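(* For $0<s<1$, let $G_1=\{(x,y)\in\mathbb{R}^2:|x|^s+|y|^s<1\}$ and $G_2=\{(x,y)\in\mathbb{R}^2:|x|+|y|<1\}$. Then $$k_{G_1}(z_1,z_2)\ge 2^{\frac1s-1}\,k_{G_2}(z_1,z_2)\quad\text{for all } z_1,z_2\in G_1.$$
   Context: For a domain (open connected nonempty set) $G\subsetneq\mathbb{R}^n$, $\delta_G(x)$ is the Euclidean distance from $x\in G$ to $\partial G$. The quasihyperbolic metric of $G$ is $$k_G(x,y)=\inf_{\gamma}\int_\gamma\frac{|dz|}{\delta_G(z)},\qquad x,y\in G,$$ where the infimum is over all rectifiable paths $\gamma$ in $G$ joining $x$ and $y$. *)

theory Defs
  imports "HOL-Analysis.Analysis"
begin

text \<open>Lengths of the polygonal paths inscribed in \<open>g\<close> restricted to \<open>[a, b]\<close>.\<close>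

definition chord_sums :: "(real \<Rightarrow> 'a::metric_space) \<Rightarrow> real \<Rightarrow> real \<Rightarrow> real set" where
  "chord_sums g a b =
     {(\<Sum>i<m. dist (g (p i)) (g (p (Suc i)))) | p (m::nat).
        mono_on {..m} p \<and> p 0 = a \<and> p m = b}"

definition rectifiable_path :: "(real \<Rightarrow> 'a::metric_space) \<Rightarrow> bool" where
  "rectifiable_path g \<longleftrightarrow> path g \<and> bdd_above (chord_sums g 0 1)"

text \<open>The length of \<open>g\<close> restricted to \<open>[0, t]\<close> for \<open>t\<close> in \<open>[0, 1]\<close>, extended by constants
  to the whole line so that it can serve as the distribution function of a measure.\<close>

definition arc_length_fun :: "(real \<Rightarrow> 'a::metric_space) \<Rightarrow> real \<Rightarrow> real" where
  "arc_length_fun g t = Sup (chord_sums g 0 (max 0 (min 1 t)))"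

text \<open>The integral of \<open>f\<close> along \<open>g\<close> with respect to arc length \<open>|dz|\<close>, as the Lebesgue-Stieltjes
  integral against the arc-length function. For a rectifiable path that function is continuous
  and nondecreasing, so the measure has no atoms and its total mass is the length of \<open>g\<close>.\<close>

definition arc_length_integral :: "(real \<Rightarrow> 'a::metric_space) \<Rightarrow> ('a \<Rightarrow> real) \<Rightarrow> real" where
  "arc_length_integral g f =
     set_lebesgue_integral (interval_measure (arc_length_fun g)) {0..1} (\<lambda>t. f (g t))"

text \<open>Meaningful for a domain \<open>G \<noteq> UNIV\<close>: then the frontier of \<open>G\<close> is nonempty and any two
  points of \<open>G\<close> are joined by a rectifiable path in \<open>G\<close>, so the infimum is over a nonempty set
  of nonnegative reals.\<close>

definition quasihyperbolic :: "'a::euclidean_space set \<Rightarrow> 'a \<Rightarrow> 'a \<Rightarrow> real" where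
  "quasihyperbolic G x y =
     (INF g \<in> {g. rectifiable_path g \<and> path_image g \<subseteq> G \<and> pathstart g = x \<and> pathfinish g = y}.
        arc_length_integral g (\<lambda>z. 1 / infdist z (frontier G)))"

end

theory Submission
  imports Defs
begin

text \<open>With \<open>C = 2 powr (1/s - 1)\<close>, one has \<open>C * d1 \<le> d2\<close> on \<open>G1\<close> for the distances \<open>d1, d2\<close> to
  the two boundaries; since \<open>G1 \<subseteq> G2\<close>, comparing the densities along each path in \<open>G1\<close> gives the
  claim. For the distance estimate take \<open>z = (x, y)\<close> with \<open>x, y \<ge> 0\<close> and go diagonally to
  \<open>w = z + (1 - x - y) *\<^sub>R (m, m)\<close>, where \<open>m = 2 powr (- 1/s)\<close>. This is the convex combination of
  \<open>(1, 0)\<close>, \<open>(0, 1)\<close> and \<open>(m, m)\<close>, all on the boundary of \<open>G1\<close>, with weights \<open>x\<close>, \<open>y\<close> and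
  \<open>1 - x - y\<close>, so by concavity of \<open>\<lambda>r. r powr s\<close> it lies outside \<open>G1\<close>.\<close>

subsection \<open>Distance to the boundary\<close>

text \<open>The segment from \<open>z\<close> to \<open>w\<close> is connected, so it meets the
  frontier, at a point no farther from \<open>z\<close> than \<open>w\<close>. Thus any exterior
  point bounds the boundary distance from above.\<close>

lemma infdist_frontier_le_dist:
  fixes S :: "'a::euclidean_space set"
  assumes "z \<in> S" "w \<notin> S"
  shows "infdist z (frontier S) \<le> dist z w"
proof -
  have "closed_segment z w \<inter> frontier S \<noteq> {}"
    using assms by (intro connected_Int_frontier) auto
  then obtain v where v: "v \<in> closed_segment z w" "v \<in> frontier S"
    by blast
  have "dist z v \<le> dist z w"
    using segment_bound(1)[OF v(1)] by (simp add: dist_norm norm_minus_commute)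
  then show ?thesis
    using v(2) infdist_le2 by blast
qed

lemma infdist_frontier_pos:
  fixes S :: "'a::euclidean_space set"
  assumes "open S" "S \<noteq> UNIV" "z \<in> S"
  shows "infdist z (frontier S) > 0"
  using assms frontier_not_empty[of S] frontier_disjoint_eq[of S]
  by (intro infdist_pos_not_in_closed) auto

text \<open>Weighted AM-GM turns \<open>u powr s * A powr (1 - s)\<close> into \<open>s * u + (1 - s) * A\<close> for \<open>u = 1\<close> and
  \<open>u = m\<close>, where \<open>A = x + t * m\<close>; this avoids the boundary point \<open>0\<close> in the concavity of
  \<open>\<lambda>r. r powr s\<close>.\<close>

lemma powr_concave_combination:
  fixes s :: real
  assumes s: "0 < s" "s < 1" and xt: "0 \<le> x" "0 \<le> t" "x + t \<le> 1" and m: "0 < m"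
  shows "x + t * m powr s \<le> (x + t * m) powr s"
proof (cases "x + t * m = 0")
  case True
  then have "x = 0" "t = 0"
    using xt m by (auto simp: add_nonneg_eq_0_iff)
  then show ?thesis by simp
next
  case False
  define A where "A = x + t * m"
  have A: "A > 0"
    using False xt m by (simp add: A_def order_less_le)
  have 1: "A powr (1 - s) \<le> s + (1 - s) * A"
    using Youngs_inequality_0[of s "1 - s" 1 A] s A by simp
  have 2: "m powr s * A powr (1 - s) \<le> s * m + (1 - s) * A"
    using Youngs_inequality_0[of s "1 - s" m A] s A m by simp
  have "(x + t * m powr s) * A powr (1 - s) = x * A powr (1 - s) + t * (m powr s * A powr (1 - s))"
    by (simp add: algebra_simps)
  also have "\<dots> \<le> x * (s + (1 - s) * A) + t * (s * m + (1 - s) * A)"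
    using 1 2 xt by (intro add_mono mult_left_mono) auto
  also have "\<dots> = s * A + (x + t) * ((1 - s) * A)"
    by (simp add: A_def algebra_simps)
  also have "\<dots> \<le> s * A + 1 * ((1 - s) * A)"
    using xt s A by (intro add_left_mono mult_right_mono) auto
  also have "\<dots> = A powr s * A powr (1 - s)"
    using A by (simp add: powr_add[symmetric] algebra_simps)
  finally show ?thesis
    using A by (simp add: A_def)
qed

lemma dist_vec2: "dist (x::real^2) y = sqrt ((x $ 1 - y $ 1)\<^sup>2 + (x $ 2 - y $ 2)\<^sup>2)"
  by (simp add: dist_norm norm_vec_def L2_set_def sum_2)

text \<open>Frontier points lie outside the open set \<open>G\<close>, so the triangle inequality
  bounds their l1-distance to \<open>z\<close> from below by the numerator. The l1 norm on the plane
  is at most \<open>sqrt 2\<close> times the Euclidean norm.\<close>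

lemma infdist_frontier_diamond_ge:
  fixes G :: "(real^2) set"
  defines "G \<equiv> {z. \<bar>z $ 1\<bar> + \<bar>z $ 2\<bar> < 1}"
  assumes "open G" "G \<noteq> UNIV" "z \<in> G"
  shows "(1 - \<bar>z $ 1\<bar> - \<bar>z $ 2\<bar>) / sqrt 2 \<le> infdist z (frontier G)"
proof -
  have ne: "frontier G \<noteq> {}"
    using assms by (intro frontier_not_empty) auto
  have "(1 - \<bar>z $ 1\<bar> - \<bar>z $ 2\<bar>) / sqrt 2 \<le> dist z w" if "w \<in> frontier G" for w
  proof -
    have "w \<notin> G"
      using that assms frontier_disjoint_eq[of G] by blast
    then have "1 - \<bar>z $ 1\<bar> - \<bar>z $ 2\<bar> \<le> \<bar>z $ 1 - w $ 1\<bar> + \<bar>z $ 2 - w $ 2\<bar>"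
      unfolding G_def by auto
    also have "\<dots> \<le> sqrt (2 * (\<bar>z $ 1 - w $ 1\<bar>\<^sup>2 + \<bar>z $ 2 - w $ 2\<bar>\<^sup>2))"
      using sum_squares_bound[of "\<bar>z $ 1 - w $ 1\<bar>" "\<bar>z $ 2 - w $ 2\<bar>"]
      by (intro real_le_rsqrt) (simp only: power2_sum, simp)
    also have "\<dots> = sqrt 2 * dist z w"
      by (simp only: dist_vec2 real_sqrt_mult power2_abs)
    finally show ?thesis
      by (simp add: field_simps)
  qed
  then show ?thesis
    using ne by (auto simp: infdist_def intro!: cINF_greatest)
qed

text \<open>Carries out the diagonal step of the overview in every quadrant; the bound is the length
  of that step.\<close>

lemma infdist_frontier_lp_le:
  fixes G :: "(real^2) set"
  assumes s: "0 < s" "s < 1"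
  defines "G \<equiv> {z. \<bar>z $ 1\<bar> powr s + \<bar>z $ 2\<bar> powr s < 1}"
  assumes z: "z \<in> G" and le: "\<bar>z $ 1\<bar> + \<bar>z $ 2\<bar> \<le> 1"
  shows "infdist z (frontier G) \<le> sqrt 2 * (2 powr (- 1 / s) * (1 - \<bar>z $ 1\<bar> - \<bar>z $ 2\<bar>))"
proof -
  define m :: real where "m = 2 powr (- 1 / s)"
  define t where "t = 1 - \<bar>z $ 1\<bar> - \<bar>z $ 2\<bar>"
  \<comment> \<open>A sign with value 1 at 0: \<open>sgn\<close> would leave a point on an axis
    unmoved in that coordinate.\<close>
  define \<sigma> :: "real \<Rightarrow> real" where "\<sigma> r = (if r < 0 then -1 else 1)" for r
  have \<sigma>: "\<bar>r + \<sigma> r * c\<bar> = \<bar>r\<bar> + c" "(\<sigma> r * c)\<^sup>2 = c\<^sup>2" if "c \<ge> 0" for r c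
    using that by (auto simp: \<sigma>_def)
  define w :: "real^2" where "w = (\<chi> i. z $ i + \<sigma> (z $ i) * (t * m))"
  have "m powr s = 2 powr (- 1)"
    unfolding m_def powr_powr using s by simp
  then have m: "m > 0" "m powr s = 1 / 2"
    by (simp_all add: m_def powr_minus_divide)
  have t: "t \<ge> 0" using le by (simp add: t_def)
  then have tm: "t * m \<ge> 0" using m by simp
  have "\<bar>z $ 1\<bar> + t * m powr s \<le> (\<bar>z $ 1\<bar> + t * m) powr s"
       "\<bar>z $ 2\<bar> + t * m powr s \<le> (\<bar>z $ 2\<bar> + t * m) powr s"
    using s t m by (auto intro!: powr_concave_combination simp: t_def)
  \<comment> \<open>The two lower bounds add up to
    \<open>\<bar>z $ 1\<bar> + \<bar>z $ 2\<bar> + 2 * t * (1 / 2)\<close>, which is 1 by the choice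
    of \<open>t\<close>.\<close>
  then have "1 \<le> \<bar>w $ 1\<bar> powr s + \<bar>w $ 2\<bar> powr s"
    unfolding w_def vec_lambda_beta \<sigma>(1)[OF tm] m(2) using t_def by linarith
  then have "w \<notin> G"
    by (simp add: G_def)
  then have "infdist z (frontier G) \<le> dist z w"
    using z by (rule infdist_frontier_le_dist[rotated])
  also have "\<dots> = sqrt (2 * (t * m)\<^sup>2)"
    using \<sigma>(2)[OF tm] by (simp add: dist_vec2 w_def)
  also have "\<dots> = sqrt 2 * (m * t)"
    using tm by (simp add: real_sqrt_mult mult.commute)
  finally show ?thesis
    by (simp add: m_def t_def)
qed

subsection \<open>Rectifiable paths and integrals along them\<close>

text \<open>Each chord is at most \<open>L\<close> times its parameter increment, and the increments
  telescope to 1.\<close>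

lemma lipschitz_imp_rectifiable_path:
  fixes g :: "real \<Rightarrow> 'a::metric_space"
  assumes L: "L-lipschitz_on {0..1} g"
  shows "rectifiable_path g"
  unfolding rectifiable_path_def
proof
  show "path g"
    unfolding path_def using L by (rule lipschitz_on_continuous_on)
  have "v \<le> L" if v01: "v \<in> chord_sums g 0 1" for v
  proof -
    obtain p m where v: "v = (\<Sum>i<m. dist (g (p i)) (g (p (Suc i))))"
      and p: "mono_on {..m} p" "p 0 = 0" "p m = (1::real)"
      using v01 unfolding chord_sums_def by blast
    have in01: "p i \<in> {0..1}" if "i \<le> m" for i
      using mono_onD[OF p(1), of 0 i] mono_onD[OF p(1), of i m] that p by auto
    have "v \<le> (\<Sum>i<m. L * (p (Suc i) - p i))"
      unfolding v
    proof (rule sum_mono)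
      fix i assume "i \<in> {..<m}"
      then show "dist (g (p i)) (g (p (Suc i))) \<le> L * (p (Suc i) - p i)"
        using lipschitz_onD[OF L in01[of i] in01[of "Suc i"]] mono_onD[OF p(1), of i "Suc i"]
        by (simp add: dist_real_def)
    qed
    also have "\<dots> = L"
      using p by (simp add: sum_distrib_left[symmetric] sum_lessThan_telescope)
    finally show ?thesis .
  qed
  then show "bdd_above (chord_sums g 0 1)"
    by (rule bdd_aboveI)
qed

text \<open>The segment from \<open>x\<close> to \<open>y\<close> may leave a star-shaped set, so
  the path runs through the origin.\<close>

lemma starlike_rectifiable_path:
  fixes S :: "'a::real_normed_vector set"
  assumes star: "\<And>z c. z \<in> S \<Longrightarrow> 0 \<le> c \<Longrightarrow> c \<le> 1 \<Longrightarrow> c *\<^sub>R z \<in> S"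
    and xy: "x \<in> S" "y \<in> S"
  obtains g where "rectifiable_path g" "path_image g \<subseteq> S" "pathstart g = x" "pathfinish g = y"
proof
  \<comment> \<open>The truncations switch off one radius at a time: \<open>g\<close> reaches the
    origin at \<open>t = 1/2\<close>. A single formula gives the Lipschitz bound at once.\<close>
  define g where "g t = max 0 (1 - 2 * t) *\<^sub>R x + max 0 (2 * t - 1) *\<^sub>R y" for t :: real
  have max_diff: "\<bar>max 0 p - max 0 q\<bar> \<le> e" if "\<bar>p - q\<bar> \<le> e" for p q e :: real
    using that by linarith
  have "(2 * norm x + 2 * norm y)-lipschitz_on {0..1} g"
  proof (rule lipschitz_onI)
    fix u v :: real
    have "g u - g v = (max 0 (1 - 2 * u) - max 0 (1 - 2 * v)) *\<^sub>R x
        + (max 0 (2 * u - 1) - max 0 (2 * v - 1)) *\<^sub>R y"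
      by (simp add: g_def algebra_simps)
    then have "norm (g u - g v) \<le> \<bar>max 0 (1 - 2 * u) - max 0 (1 - 2 * v)\<bar> * norm x
        + \<bar>max 0 (2 * u - 1) - max 0 (2 * v - 1)\<bar> * norm y"
      by (metis norm_triangle_ineq norm_scaleR)
    also have "\<dots> \<le> (2 * \<bar>u - v\<bar>) * norm x + (2 * \<bar>u - v\<bar>) * norm y"
      by (intro add_mono mult_right_mono norm_ge_zero max_diff) (simp_all add: abs_if)
    finally show "dist (g u) (g v) \<le> (2 * norm x + 2 * norm y) * dist u v"
      by (simp add: dist_norm algebra_simps)
  qed simp
  then show "rectifiable_path g"
    by (rule lipschitz_imp_rectifiable_path)
  have "g t \<in> S" if "t \<in> {0..1}" for t
  proof (cases "2 * t \<le> 1")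
    case True
    then show ?thesis
      using star[OF xy(1), of "1 - 2 * t"] that by (simp add: g_def)
  next
    case False
    then show ?thesis
      using star[OF xy(2), of "2 * t - 1"] that by (simp add: g_def)
  qed
  then show "path_image g \<subseteq> S"
    by (auto simp: path_image_def)
  show "pathstart g = x" "pathfinish g = y"
    by (simp_all add: g_def pathstart_def pathfinish_def)
qed

text \<open>If \<open>F\<close> is not a distribution function, then \<open>extend_measure\<close> either still yields some measure
  with the prescribed values on half-open intervals or falls back to the null measure.\<close>

lemma emeasure_interval_measure_bounded:
  assumes "bounded A"
  shows "emeasure (interval_measure F) A < \<infinity>"
proof -
  define I where "I = {(a, b) | a b. a \<le> (b::real)}"
  define G where "G = (\<lambda>(a::real, b). {a<..b})"
  define \<mu> where "\<mu> = (\<lambda>(a, b). ennreal (F b - F a))"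
  have M: "interval_measure F = extend_measure UNIV I G \<mu>"
    unfolding interval_measure_def I_def G_def \<mu>_def by (simp add: case_prod_unfold)
  obtain r where r: "0 < r" "A \<subseteq> {-r<..r}"
  proof -
    obtain r where "r > 0" "\<forall>x\<in>A. norm x < r"
      using assms bounded_pos_less by blast
    then show ?thesis
      by (intro that[of r]) (auto simp: abs_less_iff)
  qed
  have rI: "(-r, r) \<in> I" and Gr: "G (-r, r) = {-r<..r}"
    using r by (auto simp: I_def G_def)
  have "emeasure (interval_measure F) {-r<..r} < \<infinity>"
  \<comment> \<open>The condition tested in the definition of \<open>extend_measure\<close>.\<close>
  proof (cases "(\<exists>\<mu>'. (\<forall>i\<in>I. \<mu>' (G i) = \<mu> i) \<and> measure_space UNIV (sigma_sets UNIV (G ` I)) \<mu>')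
      \<and> \<not> (\<forall>i\<in>I. \<mu> i = 0)")
    case True
    then obtain \<mu>' where \<mu>': "\<forall>i\<in>I. \<mu>' (G i) = \<mu> i"
      "measure_space UNIV (sigma_sets UNIV (G ` I)) \<mu>'"
      by blast
    have "sets (interval_measure F) = sigma_sets UNIV (G ` I)"
      unfolding M by (simp add: sets_extend_measure)
    then have "emeasure (interval_measure F) (G (-r, r)) = \<mu> (-r, r)"
      using \<mu>' rI by (intro emeasure_extend_measure[OF M, of \<mu>']) (auto simp: measure_space_def)
    then show ?thesis
      by (simp add: Gr \<mu>_def)
  next
    case False
    then have "interval_measure F = measure_of UNIV (G ` I) (\<lambda>_. 0)"
      unfolding M extend_measure_def by (rule if_not_P)
    then show ?thesis
      by (simp add: emeasure_sigma)
  qed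
  moreover have "emeasure (interval_measure F) A \<le> emeasure (interval_measure F) {-r<..r}"
    using r by (intro emeasure_mono) auto
  ultimately show ?thesis
    by (rule le_less_trans[rotated])
qed

text \<open>A continuous function is bounded on the compact interval, which has finite measure for
  every \<open>F\<close>.\<close>

lemma set_integrable_interval_measure_continuous:
  fixes f :: "real \<Rightarrow> real"
  assumes "continuous_on {a..b} f"
  shows "set_integrable (interval_measure F) {a..b} f"
proof -
  have "bounded (f ` {a..b})"
    using assms by (intro compact_imp_bounded compact_continuous_image) auto
  then obtain B where B: "\<forall>x\<in>{a..b}. norm (f x) \<le> B"
    by (auto simp: bounded_iff)
  have "(\<lambda>x. indicator {a..b} x *\<^sub>R f x) \<in> borel_measurable (interval_measure F)"
    using borel_measurable_continuous_on_indicator[OF _ assms]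
    by (simp cong: measurable_cong_sets)
  then show ?thesis
    unfolding set_integrable_def
    using B emeasure_interval_measure_bounded[of "{a..b}" F]
    by (intro integrableI_bounded_set[where A = "{a..b}" and B = B]) (auto intro!: AE_I2)
qed

lemma set_integrable_quasihyperbolic_density:
  fixes G :: "'a::euclidean_space set"
  assumes "path g" "path_image g \<subseteq> G" "open G" "G \<noteq> UNIV"
  shows "set_integrable (interval_measure F) {0..1} (\<lambda>t. 1 / infdist (g t) (frontier G))"
proof (rule set_integrable_interval_measure_continuous)
  have "infdist (g t) (frontier G) \<noteq> 0" if "t \<in> {0..1}" for t
    using infdist_frontier_pos[OF assms(3,4), of "g t"] assms(2) that
    by (force simp: path_image_def)
  then show "continuous_on {0..1} (\<lambda>t. 1 / infdist (g t) (frontier G))"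
    using assms(1) unfolding path_def
    by (intro continuous_intros) blast+
qed

section \<open>Comparison of quasihyperbolic metrics\<close>

lemma arc_length_integral_nonneg:
  "(\<And>z. f z \<ge> 0) \<Longrightarrow> arc_length_integral g f \<ge> 0"
  unfolding arc_length_integral_def set_lebesgue_integral_def
  by (intro Bochner_Integration.integral_nonneg) auto

text \<open>Every path in \<open>G1\<close> also competes in the infimum for \<open>G2\<close>, and
  \<open>le\<close> compares the two densities along it. Assumption \<open>ex\<close> keeps the
  infimum for \<open>G1\<close> from being taken over the empty set.\<close>

lemma quasihyperbolic_mono_density:
  fixes G1 G2 :: "'a::euclidean_space set"
  assumes G1: "open G1" and G2: "open G2" "G2 \<noteq> UNIV" and sub: "G1 \<subseteq> G2" and C: "C \<ge> 0"
    and le: "\<And>z. z \<in> G1 \<Longrightarrow> C * infdist z (frontier G1) \<le> infdist z (frontier G2)"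
    and ex: "\<exists>g. rectifiable_path g \<and> path_image g \<subseteq> G1 \<and> pathstart g = x \<and> pathfinish g = y"
  shows "C * quasihyperbolic G2 x y \<le> quasihyperbolic G1 x y"
  unfolding quasihyperbolic_def[of G1]
proof (rule cINF_greatest)
  show "{g. rectifiable_path g \<and> path_image g \<subseteq> G1 \<and> pathstart g = x \<and> pathfinish g = y} \<noteq> {}"
    using ex by blast
next
  fix g
  assume "g \<in> {g. rectifiable_path g \<and> path_image g \<subseteq> G1 \<and> pathstart g = x \<and> pathfinish g = y}"
  then have g: "rectifiable_path g" "path_image g \<subseteq> G1" "pathstart g = x" "pathfinish g = y"
    by auto
  have pg: "path g" using g(1) by (simp add: rectifiable_path_def)
  have UNIV1: "G1 \<noteq> UNIV" using sub G2 by auto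
  let ?d1 = "\<lambda>z. infdist z (frontier G1)" and ?d2 = "\<lambda>z. infdist z (frontier G2)"
  let ?M = "interval_measure (arc_length_fun g)"
  \<comment> \<open>Nonnegative integrals supply the lower bound required by the conditionally
    complete infimum.\<close>
  have "quasihyperbolic G2 x y \<le> arc_length_integral g (\<lambda>z. 1 / ?d2 z)"
    unfolding quasihyperbolic_def using g sub
    by (intro cINF_lower bdd_belowI2[where m = 0])
       (auto intro!: arc_length_integral_nonneg simp: infdist_nonneg)
  then have "C * quasihyperbolic G2 x y \<le> C * arc_length_integral g (\<lambda>z. 1 / ?d2 z)"
    using C by (rule mult_left_mono)
  also have "\<dots> = (LINT t:{0..1}|?M. C * (1 / ?d2 (g t)))"
    unfolding arc_length_integral_def by (rule set_integral_mult_right[symmetric])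
  also have "\<dots> \<le> (LINT t:{0..1}|?M. 1 / ?d1 (g t))"
  proof (rule set_integral_mono)
    show "set_integrable ?M {0..1} (\<lambda>t. C * (1 / ?d2 (g t)))"
      using g(2) sub
      by (intro set_integrable_mult_right set_integrable_quasihyperbolic_density pg G2) auto
    show "set_integrable ?M {0..1} (\<lambda>t. 1 / ?d1 (g t))"
      by (intro set_integrable_quasihyperbolic_density pg g(2) G1 UNIV1)
    fix t :: real
    assume "t \<in> {0..1}"
    then have t: "g t \<in> G1"
      using g(2) by (auto simp: path_image_def)
    have "?d1 (g t) > 0" "?d2 (g t) > 0"
      using t sub by (auto intro!: infdist_frontier_pos G1 G2 UNIV1)
    then show "C * (1 / ?d2 (g t)) \<le> 1 / ?d1 (g t)"
      using le[OF t] by (simp add: field_simps)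
  qed
  finally show "C * quasihyperbolic G2 x y \<le> arc_length_integral g (\<lambda>z. 1 / ?d1 z)"
    unfolding arc_length_integral_def .
qed

theorem theorem4p3:
  fixes s :: real and G1 G2 :: "(real ^ 2) set"
  assumes "0 < s" and "s < 1"
    and "G1 = {z. \<bar>z $ 1\<bar> powr s + \<bar>z $ 2\<bar> powr s < 1}"
    and "G2 = {z. \<bar>z $ 1\<bar> + \<bar>z $ 2\<bar> < 1}"
  shows "\<forall>z1\<in>G1. \<forall>z2\<in>G1.
           quasihyperbolic G1 z1 z2 \<ge> 2 powr (1 / s - 1) * quasihyperbolic G2 z1 z2"
proof (intro ballI quasihyperbolic_mono_density)
  note s = assms(1,2) and G1_def = assms(3) and G2_def = assms(4)
  \<comment> \<open>Positivity of \<open>s\<close> makes \<open>powr\<close> continuous also at base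
    0, that is, on the coordinate axes.\<close>
  show "open G1"
    unfolding G1_def using s
    by (intro open_Collect_less continuous_on_add continuous_on_powr' continuous_intros) auto
  show G2: "open G2"
    unfolding G2_def by (intro open_Collect_less continuous_intros)
  have "(\<chi> i. 1) \<notin> G2"
    by (simp add: G2_def)
  then show UNIV2: "G2 \<noteq> UNIV"
    by blast
  have powr_ge: "r \<le> r powr s" if "0 \<le> r" "r powr s < 1" for r
    using that s powr_mono'[of s 1 r] ge_one_powr_ge_zero[of r s] by (cases "r \<le> 1") auto
  show sub: "G1 \<subseteq> G2"
  proof
    fix z
    assume "z \<in> G1"
    then have z: "\<bar>z $ 1\<bar> powr s + \<bar>z $ 2\<bar> powr s < 1"
      by (simp add: G1_def)
    moreover have "\<bar>z $ 1\<bar> powr s < 1" "\<bar>z $ 2\<bar> powr s < 1"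
      using z powr_ge_zero[of "\<bar>z $ 1\<bar>" s] powr_ge_zero[of "\<bar>z $ 2\<bar>" s] by linarith+
    ultimately show "z \<in> G2"
      using powr_ge[of "\<bar>z $ 1\<bar>"] powr_ge[of "\<bar>z $ 2\<bar>"] by (simp add: G2_def)
  qed
  show "0 \<le> 2 powr (1 / s - 1)"
    by simp
  show "2 powr (1 / s - 1) * infdist z (frontier G1) \<le> infdist z (frontier G2)" if z: "z \<in> G1" for z
  proof -
    let ?t = "1 - \<bar>z $ 1\<bar> - \<bar>z $ 2\<bar>"
    have z2: "z \<in> G2" using z sub by blast
    have "infdist z (frontier G1) \<le> sqrt 2 * (2 powr (- 1 / s) * ?t)"
      using infdist_frontier_lp_le[OF s, of z] z z2 by (simp add: G1_def G2_def)
    then have "2 powr (1 / s - 1) * infdist z (frontier G1)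
        \<le> 2 powr (1 / s - 1) * (sqrt 2 * (2 powr (- 1 / s) * ?t))"
      by (rule mult_left_mono) simp
    also have "\<dots> = (2 powr (1 / s - 1) * 2 powr (- 1 / s)) * sqrt 2 * ?t"
      by (simp only: mult_ac)
    \<comment> \<open>The exponents add up to -1, and the remaining factor \<open>sqrt 2 / 2\<close>
      is exactly the \<open>1 / sqrt 2\<close> of the diamond estimate.\<close>
    also have "2 powr (1 / s - 1) * 2 powr (- 1 / s) = (1 / 2 :: real)"
      unfolding powr_add[symmetric] by (simp add: powr_minus_divide)
    also have "1 / 2 * sqrt 2 * ?t = ?t / sqrt 2"
      by (simp add: field_simps)
    also have "\<dots> \<le> infdist z (frontier G2)"
      using infdist_frontier_diamond_ge[of z] G2 UNIV2 z2 by (simp add: G2_def)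
    finally show ?thesis .
  qed
  fix z1 z2
  assume z12: "z1 \<in> G1" "z2 \<in> G1"
  \<comment> \<open>\<open>G1\<close> is star-shaped about the origin, since shrinking a coordinate
    decreases its power.\<close>
  have "c *\<^sub>R z \<in> G1" if "z \<in> G1" "0 \<le> c" "c \<le> 1" for z c
  proof -
    have "\<bar>c * z $ i\<bar> powr s \<le> \<bar>z $ i\<bar> powr s" for i
      using that s by (intro powr_mono2) (auto simp: abs_mult mult_left_le_one_le)
    from this[of 1] this[of 2] show ?thesis
      using that(1) by (simp add: G1_def)
  qed
  then show "\<exists>g. rectifiable_path g \<and> path_image g \<subseteq> G1 \<and> pathstart g = z1 \<and> pathfinish g = z2"
    using starlike_rectifiable_path[of G1 z1 z2] z12 by metis
qed

end
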